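(* Let $\mathcal{P}\subseteq\mathbb{R}^n$ be a polytope, $h:\mathcal{P}\to\mathbb{R}$ differentiable and $x_0\in\mathcal{P}$. Let $x_{i-1}\in\mathcal{P}$ be the $i$th breakpoint in the projections curve $g(\lambda)=\Pi_{\mathcal{P}}(x_0-\lambda\nabla h(x_0))$, $\lambda\ge 0$, with $x_{i-1}=x_0$ for $i=1$. Let $\lambda_{i-1}\in\mathbb{R}_+$ be such that $g(\lambda_{i-1})=x_{i-1}$. If $d_{x_{i-1}}^\Pi(\nabla h(x_0))=0$, then $\lim_{\lambda\to\infty}g(\lambda)=x_{i-1}$ is the end point of $g$. Otherwise $d_{x_{i-1}}^\Pi(\nabla h(x_0))\neq0$, and the following holds: (a) (Shadow steps) If $\langle x_0-\lambda_{i-1}\nabla h(x_0)-x_{i-1},\ d_{x_{i-1}}^\Pi(\nabla h(x_0))\rangle=0$, then the next breakpoint of the projections curve is obtained by moving maximally in the shadow direction, i.e. it is $$x_i:=x_{i-1}+(\lambda_i^--\lambda_{i-1})\,d_{x_{i-1}}^\Pi(\nabla h(x_0)),$$ where $\lambda_i^-=\lambda_{i-1}+\max\{\delta: x_{i-1}+\delta\, d_{x_{i-1}}^\Pi(\nabla h(x_0))\in\mathcal{P}\}$. (b) (In-face steps) Otherwise, $\langle x_0-\lambda_{i-1}\nabla h(x_0)-x_{i-1},\ d_{x_{i-1}}^\Pi(\nabla h(x_0))\rangle\ne0$, and the next breakpoint is obtained by moving in the in-face direction until the normal cone changes, i.e. it is $$x_i:=x_{i-1}+(\hat\lambda_{i-1}-\lambda_{i-1})\,\hat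 d_{x_{i-1}}^\Pi(\nabla h(x_0)),$$ where $\hat\lambda_{i-1}:=\sup\{\lambda: N_{\mathcal{P}}(g(\lambda'))=N_{\mathcal{P}}(x_{i-1})\ \forall\lambda'\in[\lambda_{i-1},\lambda)\}$.
   Context: $\mathcal{P}=\{x\in\mathbb{R}^n:\langle a_j,x\rangle\le b_j,\ j\in[m]\}$; $\Pi_{\mathcal{P}}$ is Euclidean projection onto $\mathcal{P}$; $I(x)$ is the index set of constraints tight at $x$ and $A_{I(x)}$ the corresponding submatrix. Normal cone: $N_{\mathcal{P}}(x)=\{y:\langle y,z-x\rangle\le0\ \forall z\in\mathcal{P}\}$. The shadow (directional derivative) is $d_x^\Pi(w)=\lim_{\epsilon\downarrow0}\frac{\Pi_{\mathcal{P}}(x-\epsilon w)-x}{\epsilon}$, which equals $\arg\min\{\|-w-d\|^2: A_{I(x)}d\le0\}$. The in-face shadow is $\hat d_x^\Pi(w)=\arg\min\{\|-w-d\|^2: A_{I(x)}d=0\}$, the projection of $-w$ onto the in-face feasible directions of the minimal face of $\mathcal{P}$ containing $x$. The curve $g$ is continuous and piecewise affine in $\lambda$; its breakpoints are, in order, the starting point $x_0$ and the successive end points of the maximal $\lambda$-intervals on which $g$ is affine and non-constant. Let $\lambda_{i-1}^+=\max\{\lambda: g(\lambda)=x_{i-1}\}$. Convention: in case (b), if $\lambda_{i-1}<\lambda_{i-1}^+$, the curve moves trivially in-face on $[\lambda_{i-1},\lambda_{i-1}^+]$ with $\hat d_{x_{i-1}}^\Pi(\nabla h(x_0))=0$ and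 $\hat\lambda_{i-1}=\lambda_{i-1}^+$ (the step then stays at $x_{i-1}$); otherwise one moves along $\hat d_{x_{i-1}}^\Pi(\nabla h(x_0))\neq 0$.
   Formalization: In case (b) with λ_{i-1}=λ_{i-1}^+, the claim that x_i is the next breakpoint and the in-face shadow is nonzero is made only if λ_{i-1}<λ̂_{i-1}; if the normal cone changes at once, the formula gives x_i=x_{i-1}, which is not the next breakpoint, so the original claim fails. *)

theory Defs
  imports "HOL-Analysis.Analysis"
begin

definition tight_constraints ::
    "(nat \<Rightarrow> real^'n) \<Rightarrow> (nat \<Rightarrow> real) \<Rightarrow> nat \<Rightarrow> real^'n \<Rightarrow> nat set" where
  "tight_constraints a b m x = {j \<in> {1..m}. a j \<bullet> x = b j}"

definition normal_cone :: "(real^'n) set \<Rightarrow> real^'n \<Rightarrow> (real^'n) set" where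
  "normal_cone P x = {y. \<forall>z\<in>P. y \<bullet> (z - x) \<le> 0}"

definition shadow :: "(real^'n) set \<Rightarrow> real^'n \<Rightarrow> real^'n \<Rightarrow> real^'n" where
  "shadow P x w =
     Lim (at_right 0) (\<lambda>\<epsilon>. (1 / \<epsilon>) *\<^sub>R (closest_point P (x - \<epsilon> *\<^sub>R w) - x))"

(* closest_point S (- w) is the minimizer of the distance from - w over S, which is unique
   because the set below is a linear subspace. *)
definition in_face_shadow ::
    "(nat \<Rightarrow> real^'n) \<Rightarrow> (nat \<Rightarrow> real) \<Rightarrow> nat \<Rightarrow> real^'n \<Rightarrow> real^'n \<Rightarrow> real^'n" where
  "in_face_shadow a b m x w =
     closest_point {d. \<forall>j\<in>tight_constraints a b m x. a j \<bullet> d = 0} (- w)"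

definition projections_curve ::
    "(real^'n) set \<Rightarrow> real^'n \<Rightarrow> real^'n \<Rightarrow> real \<Rightarrow> real^'n" where
  "projections_curve P x0 w l = closest_point P (x0 - l *\<^sub>R w)"

text \<open>
  A curve is a function of a real parameter that is only considered for parameter values
  \<open>l \<ge> 0\<close>. Since the curves of interest are continuous and bounded, the maximal
  intervals on which they are affine and non-constant are compact.
\<close>

definition affine_piece :: "(real \<Rightarrow> real^'n) \<Rightarrow> real \<Rightarrow> real \<Rightarrow> bool" where
  "affine_piece g s t \<longleftrightarrow>
     0 \<le> s \<and> s < t \<and> (\<exists>v. v \<noteq> 0 \<and> (\<forall>l\<in>{s..t}. g l = g s + (l - s) *\<^sub>R v))"

definition maximal_affine_piece :: "(real \<Rightarrow> real^'n) \<Rightarrow> real \<Rightarrow> real \<Rightarrow> bool" where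
  "maximal_affine_piece g s t \<longleftrightarrow>
     affine_piece g s t \<and>
     (\<forall>s' t'. affine_piece g s' t' \<and> {s..t} \<subseteq> {s'..t'} \<longrightarrow> s' = s \<and> t' = t)"

definition piece_ends :: "(real \<Rightarrow> real^'n) \<Rightarrow> real set" where
  "piece_ends g = {t. \<exists>s. maximal_affine_piece g s t}"

text \<open>
  Breakpoints are numbered from 1. The first one is the starting point; for \<open>i \<ge> 2\<close>
  the \<open>i\<close>-th one is the end point of the \<open>(i - 1)\<close>-st maximal piece, the one with
  exactly \<open>i - 2\<close> earlier piece ends.
\<close>

definition nth_breakpoint :: "(real \<Rightarrow> real^'n) \<Rightarrow> nat \<Rightarrow> real^'n \<Rightarrow> bool" where
  "nth_breakpoint g i x \<longleftrightarrow>
     (i = 1 \<and> x = g 0) \<or>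
     (\<exists>t\<in>piece_ends g.
        finite {t'\<in>piece_ends g. t' < t} \<and>
        i = card {t'\<in>piece_ends g. t' < t} + 2 \<and>
        x = g t)"

text \<open>
  On \<open>real\<close>, \<open>GREATEST\<close> denotes the attained maximum, unlike \<open>Sup\<close>.
\<close>

definition last_parameter :: "(real \<Rightarrow> real^'n) \<Rightarrow> real^'n \<Rightarrow> real" where
  "last_parameter g x = (GREATEST l. 0 \<le> l \<and> g l = x)"

definition max_step :: "(real^'n) set \<Rightarrow> real^'n \<Rightarrow> real^'n \<Rightarrow> real" where
  "max_step P x d = (GREATEST \<delta>. x + \<delta> *\<^sub>R d \<in> P)"

definition normal_cone_change ::
    "(real^'n) set \<Rightarrow> (real \<Rightarrow> real^'n) \<Rightarrow> real^'n \<Rightarrow> real \<Rightarrow> real" where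
  "normal_cone_change P g x l0 =
     Sup {l. \<forall>l'\<in>{l0..<l}. normal_cone P (g l') = normal_cone P x}"

end

theory Submission
  imports Defs
begin

text \<open>
  A point \<open>p\<close> of \<open>P\<close> is the projection of \<open>y\<close> exactly when the residual \<open>y - p\<close> lies in the normal
  cone at \<open>p\<close>. Every assertion that the curve passes through a point at a parameter is thus a membership
  in a normal cone (\<open>projections_curve_eq_iff\<close>), and the residual of \<open>g l\<close>
  is \<open>x0 - l w - g l\<close>.

  Near \<open>x\<close> the polyhedron is \<open>x\<close> plus its tangent cone, so the shadow \<open>d\<close> is the projection of
  \<open>- w\<close> onto that cone. By Moreau's decomposition, \<open>- w - d\<close> is normal at \<open>x\<close>, orthogonal
  to \<open>d\<close>, and \<open>d\<close> is feasible (\<open>shadow_decomposition\<close>). If \<open>d = 0\<close>, then \<open>- w\<close> is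
  normal at \<open>x\<close>, adding nonnegative multiples of it to the residual keeps the residual normal, and the curve stays
  at \<open>x\<close>. If \<open>d \<noteq> 0\<close> and the residual at \<open>l0\<close> is orthogonal to \<open>d\<close>, then after moving
  by \<open>\<delta> d\<close> the residual has grown by \<open>\<delta> (- w - d)\<close>; it is still normal at \<open>x\<close> and orthogonal to
  \<open>d\<close>, hence normal at \<open>x + \<delta> d\<close> as long as this point belongs to \<open>P\<close>
  (\<open>projections_curve_shadow_step\<close>). Leaving \<open>P\<close> is the only way for this piece to end.

  In the remaining case, as long as the normal cone of \<open>g l\<close> is that of \<open>x\<close>, the tight constraints
  do not change either. The displacement \<open>g l - x\<close> then lies in the subspace of in-face directions, to which
  all residuals are orthogonal, so it equals \<open>l - l0\<close> times the projection of \<open>- w\<close> onto this subspace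
  (\<open>projections_curve_in_face_step\<close>). The normal cone has to change at a finite parameter, for
  otherwise the residuals divided by \<open>l\<close> would tend to \<open>- w\<close> within the normal cone and force
  \<open>d = 0\<close> (\<open>normal_cone_unbounded_parameters\<close>). If the in-face direction is not zero, the piece ends there,
  since the normal cone is constant in the interior of every affine piece.

  The numbering of breakpoints uses only that the parameters with \<open>g l = x\<close> form an interval, by convexity of the
  normal cone: a non-constant piece that starts at a breakpoint and is maximal to the right is a maximal
  piece, and it is the next one (\<open>next_breakpoint\<close>).
\<close>

section \<open>Projections and normal cones\<close>

lemma closest_point_eq_iff_normal_cone:
  fixes S :: "(real^'n) set"
  assumes "closed S" "convex S" "p \<in> S"
  shows "closest_point S y = p \<longleftrightarrow> y - p \<in> normal_cone S p"
proof
  assume "closest_point S y = p"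
  then show "y - p \<in> normal_cone S p"
    using closest_point_dot[OF assms(2,1)] unfolding normal_cone_def by blast
next
  assume N: "y - p \<in> normal_cone S p"
  have "dist y p \<le> dist y z" if "z \<in> S" for z
  proof -
    have "(y - p) \<bullet> (z - p) \<le> 0"
      using N that by (simp add: normal_cone_def)
    moreover have "(y - z) \<bullet> (y - z)
        = (y - p) \<bullet> (y - p) - 2 * ((y - p) \<bullet> (z - p)) + (z - p) \<bullet> (z - p)"
      by (simp add: algebra_simps inner_commute)
    ultimately have "(y - p) \<bullet> (y - p) \<le> (y - z) \<bullet> (y - z)"
      using inner_ge_zero[of "z - p"] by linarith
    then show ?thesis
      by (simp add: dist_norm norm_le)
  qed
  then show "closest_point S y = p"
    using closest_point_unique[OF assms(2,1,3), of y] by simp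
qed

text \<open>For a cone, testing the variational inequality at twice the projection and at the apex
  gives both signs of the inner product: this is Moreau's decomposition.\<close>

lemma closest_point_cone:
  fixes T :: "(real^'n) set" and y :: "real^'n"
  assumes "closed T" "convex T" "cone T" "T \<noteq> {}"
  defines "d \<equiv> closest_point T y"
  shows "d \<in> T" "(y - d) \<bullet> d = 0" "\<And>v. v \<in> T \<Longrightarrow> (y - d) \<bullet> v \<le> 0"
proof -
  show d: "d \<in> T"
    unfolding d_def using assms(1,4) by (rule closest_point_in_set)
  have N: "(y - d) \<bullet> (v - d) \<le> 0" if "v \<in> T" for v
    unfolding d_def using closest_point_dot[OF assms(2,1) that] .
  have "2 *\<^sub>R d \<in> T" "0 *\<^sub>R d \<in> T"
    using \<open>cone T\<close> d unfolding cone_def by (auto simp del: scaleR_zero_left)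
  from N[OF this(1)] N[OF this(2)] show orth: "(y - d) \<bullet> d = 0"
    by (simp add: algebra_simps)
  show "(y - d) \<bullet> v \<le> 0" if "v \<in> T" for v
    using N[OF that] orth by (simp add: inner_diff_right)
qed

lemma convex_normal_cone: "convex (normal_cone P x)"
proof (rule convexI)
  fix y z and u v :: real
  assume yz: "y \<in> normal_cone P x" "z \<in> normal_cone P x" and uv: "0 \<le> u" "0 \<le> v" "u + v = 1"
  show "u *\<^sub>R y + v *\<^sub>R z \<in> normal_cone P x"
    unfolding normal_cone_def
  proof (intro CollectI ballI)
    fix q assume "q \<in> P"
    then have "u * (y \<bullet> (q - x)) \<le> 0" "v * (z \<bullet> (q - x)) \<le> 0"
      using yz uv by (auto simp: normal_cone_def mult_nonneg_nonpos)
    then show "(u *\<^sub>R y + v *\<^sub>R z) \<bullet> (q - x) \<le> 0"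
      by (simp add: inner_add_left)
  qed
qed

text \<open>A linear functional that attains its maximum over \<open>P\<close> inside a segment contained in
  \<open>P\<close> is constant on that segment.\<close>

lemma normal_cone_constant_along_open_segment:
  assumes seg: "\<And>l. l \<in> {s..t} \<Longrightarrow> c + l *\<^sub>R v \<in> P"
    and p: "p \<in> {s<..<t}" and q: "q \<in> {s<..<t}"
  shows "normal_cone P (c + p *\<^sub>R v) = normal_cone P (c + q *\<^sub>R v)"
proof -
  have sub: "normal_cone P (c + p *\<^sub>R v) \<subseteq> normal_cone P (c + q *\<^sub>R v)"
    if p: "p \<in> {s<..<t}" for p q
  proof
    fix y assume y: "y \<in> normal_cone P (c + p *\<^sub>R v)"
    have "y \<bullet> ((c + s *\<^sub>R v) - (c + p *\<^sub>R v)) \<le> 0" "y \<bullet> ((c + t *\<^sub>R v) - (c + p *\<^sub>R v)) \<le> 0"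
      using y seg[of s] seg[of t] p by (auto simp: normal_cone_def)
    then have "(s - p) * (y \<bullet> v) \<le> 0" "(t - p) * (y \<bullet> v) \<le> 0"
      by (simp_all add: algebra_simps)
    then have "y \<bullet> v = 0"
      using p by (auto simp: mult_le_0_iff)
    then show "y \<in> normal_cone P (c + q *\<^sub>R v)"
      using y by (simp add: normal_cone_def inner_diff_right inner_add_right)
  qed
  show ?thesis
    using sub[OF p] sub[OF q] by blast
qed

section \<open>Feasible directions of a polyhedron\<close>

lemma tight_feasible_direction:
  fixes a :: "nat \<Rightarrow> real^'n"
  assumes P: "P = {z. \<forall>j\<in>{1..m}. a j \<bullet> z \<le> b j}" and x: "x \<in> P"
    and v: "\<And>j. j \<in> tight_constraints a b m x \<Longrightarrow> a j \<bullet> v \<le> 0"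
  shows "\<exists>e>0. \<forall>\<delta>\<in>{0..e}. x + \<delta> *\<^sub>R v \<in> P"
proof -
  have "\<forall>\<^sub>F \<delta> in at_right 0. a j \<bullet> (x + \<delta> *\<^sub>R v) \<le> b j" if j: "j \<in> {1..m}" for j
  proof (cases "a j \<bullet> x = b j")
    case True
    then have "a j \<bullet> v \<le> 0"
      using v j by (simp add: tight_constraints_def)
    then show ?thesis
      using True by (auto simp: eventually_at_right_field inner_add_right mult_nonneg_nonpos intro!: exI[of _ 1])
  next
    case False
    then have "a j \<bullet> x < b j"
      using x j P by force
    moreover have "((\<lambda>\<delta>. a j \<bullet> (x + \<delta> *\<^sub>R v)) \<longlongrightarrow> a j \<bullet> (x + 0 *\<^sub>R v)) (at_right 0)"
      by (intro tendsto_intros)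
    ultimately have "\<forall>\<^sub>F \<delta> in at_right 0. a j \<bullet> (x + \<delta> *\<^sub>R v) < b j"
      by (intro order_tendstoD) auto
    then show ?thesis
      by eventually_elim simp
  qed
  then have "\<forall>\<^sub>F \<delta> in at_right 0. x + \<delta> *\<^sub>R v \<in> P"
    unfolding P mem_Collect_eq by (intro eventually_ball_finite) auto
  then obtain e where e: "e > 0" "\<And>\<delta>. 0 < \<delta> \<Longrightarrow> \<delta> < e \<Longrightarrow> x + \<delta> *\<^sub>R v \<in> P"
    unfolding eventually_at_right_field by auto
  have "x + \<delta> *\<^sub>R v \<in> P" if "\<delta> \<in> {0..e/2}" for \<delta>
    using e that x by (cases "\<delta> = 0") auto
  then show ?thesis
    using \<open>e > 0\<close> by (intro exI[of _ "e/2"]) auto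
qed

text \<open>A constraint vector \<open>a j\<close> that is tight at \<open>x\<close> is normal at \<open>x\<close>, hence at \<open>y\<close>, so \<open>y\<close> maximizes
  \<open>a j\<close> over \<open>P\<close> just as \<open>x\<close> does.\<close>

lemma normal_cone_eq_imp_tight_eq:
  fixes a :: "nat \<Rightarrow> real^'n"
  assumes P: "P = {z. \<forall>j\<in>{1..m}. a j \<bullet> z \<le> b j}" and x: "x \<in> P" and y: "y \<in> P"
    and eq: "normal_cone P y = normal_cone P x"
  shows "tight_constraints a b m y = tight_constraints a b m x"
proof -
  have sub: "tight_constraints a b m x \<subseteq> tight_constraints a b m y"
    if x: "x \<in> P" and y: "y \<in> P" and eq: "normal_cone P y = normal_cone P x" for x y
  proof
    fix j assume j: "j \<in> tight_constraints a b m x"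
    then have "a j \<in> normal_cone P x"
      by (auto simp: tight_constraints_def normal_cone_def P inner_diff_right)
    then have "a j \<bullet> (x - y) \<le> 0"
      using x eq by (auto simp: normal_cone_def)
    moreover have "a j \<bullet> y \<le> b j"
      using y j P by (auto simp: tight_constraints_def)
    ultimately show "j \<in> tight_constraints a b m y"
      using j by (auto simp: tight_constraints_def inner_diff_right)
  qed
  show ?thesis
    using sub[OF x y eq] sub[OF y x eq[symmetric]] by blast
qed

text \<open>In-face directions are feasible together with their opposites, so no normal vector has a
  component along them.\<close>

lemma normal_cone_orthogonal_in_face:
  fixes a :: "nat \<Rightarrow> real^'n"
  assumes P: "P = {z. \<forall>j\<in>{1..m}. a j \<bullet> z \<le> b j}" and x: "x \<in> P"
    and y: "y \<in> normal_cone P x"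
    and v: "\<And>j. j \<in> tight_constraints a b m x \<Longrightarrow> a j \<bullet> v = 0"
  shows "y \<bullet> v = 0"
proof -
  have nonpos: "y \<bullet> u \<le> 0" if u: "\<And>j. j \<in> tight_constraints a b m x \<Longrightarrow> a j \<bullet> u = 0" for u
  proof -
    have "\<exists>e>0. \<forall>\<delta>\<in>{0..e}. x + \<delta> *\<^sub>R u \<in> P"
      by (rule tight_feasible_direction[OF P x]) (simp add: u)
    then obtain e where e: "e > 0" "\<forall>\<delta>\<in>{0..e}. x + \<delta> *\<^sub>R u \<in> P"
      by blast
    then have "x + e *\<^sub>R u \<in> P" by auto
    then have "y \<bullet> (x + e *\<^sub>R u - x) \<le> 0"
      using y unfolding normal_cone_def by blast
    then show ?thesis
      using \<open>e > 0\<close> by (simp add: mult_le_0_iff)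
  qed
  show ?thesis
    using nonpos[of v] nonpos[of "- v"] v by simp
qed

text \<open>Since a polyhedron agrees near \<open>x\<close> with \<open>x\<close> plus its tangent cone, the difference quotients
  that define the shadow are eventually constant, equal to the projection \<open>d\<close> of \<open>- w\<close> onto the
  tangent cone. The three properties below are Moreau's decomposition \<open>- w = (- w - d) + d\<close> into a
  normal vector and an orthogonal feasible direction; the curve is analysed through them alone.\<close>

lemma shadow_decomposition:
  fixes a :: "nat \<Rightarrow> real^'n"
  assumes P: "P = {z. \<forall>j\<in>{1..m}. a j \<bullet> z \<le> b j}" and x: "x \<in> P"
    and cl: "closed P" and cv: "convex P"
  shows "- w - shadow P x w \<in> normal_cone P x"
    and "(- w - shadow P x w) \<bullet> shadow P x w = 0"
    and "\<exists>e>0. \<forall>\<delta>\<in>{0..e}. x + \<delta> *\<^sub>R shadow P x w \<in> P"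
proof -
  define I where "I = tight_constraints a b m x"
  define T where "T = {v. \<forall>j\<in>I. a j \<bullet> v \<le> 0}"
  define d where "d = closest_point T (- w)"
  have T_eq: "T = (\<Inter>j\<in>I. {v. a j \<bullet> v \<le> 0})"
    by (auto simp: T_def)
  have "closed T" "convex T"
    unfolding T_eq by (auto intro: closed_halfspace_le convex_INT convex_halfspace_le)
  moreover have "cone T"
    by (auto simp: cone_def T_def mult_nonneg_nonpos)
  moreover have "0 \<in> T"
    by (simp add: T_def)
  ultimately have d: "d \<in> T" "(- w - d) \<bullet> d = 0" "\<And>v. v \<in> T \<Longrightarrow> (- w - d) \<bullet> v \<le> 0"
    unfolding d_def by (auto intro!: closest_point_cone)
  have N: "(- w - d) \<bullet> (z - x) \<le> 0" if "z \<in> P" for z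
  proof -
    have "z - x \<in> T"
      using that P by (auto simp: T_def I_def tight_constraints_def inner_diff_right)
    then show ?thesis by (rule d)
  qed
  have "\<exists>e>0. \<forall>\<delta>\<in>{0..e}. x + \<delta> *\<^sub>R d \<in> P"
    by (rule tight_feasible_direction[OF P x]) (use d(1) in \<open>simp add: T_def I_def\<close>)
  then obtain e where e: "e > 0" "\<forall>\<delta>\<in>{0..e}. x + \<delta> *\<^sub>R d \<in> P"
    by blast
  have quotient: "(1 / \<epsilon>) *\<^sub>R (closest_point P (x - \<epsilon> *\<^sub>R w) - x) = d" if "0 < \<epsilon>" "\<epsilon> < e" for \<epsilon>
  proof -
    have in_P: "x + \<epsilon> *\<^sub>R d \<in> P"
      using e that by auto
    have "(x - \<epsilon> *\<^sub>R w - (x + \<epsilon> *\<^sub>R d)) \<bullet> (z - (x + \<epsilon> *\<^sub>R d)) \<le> 0" if "z \<in> P" for z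
    proof -
      have "(x - \<epsilon> *\<^sub>R w - (x + \<epsilon> *\<^sub>R d)) \<bullet> (z - (x + \<epsilon> *\<^sub>R d))
          = \<epsilon> * ((- w - d) \<bullet> (z - x)) - \<epsilon> * \<epsilon> * ((- w - d) \<bullet> d)"
        by (simp add: algebra_simps)
      then show ?thesis
        using N[OF that] d(2) \<open>0 < \<epsilon>\<close> by (simp add: mult_le_0_iff)
    qed
    then have "x - \<epsilon> *\<^sub>R w - (x + \<epsilon> *\<^sub>R d) \<in> normal_cone P (x + \<epsilon> *\<^sub>R d)"
      by (simp add: normal_cone_def)
    then have "closest_point P (x - \<epsilon> *\<^sub>R w) = x + \<epsilon> *\<^sub>R d"
      using closest_point_eq_iff_normal_cone[OF cl cv in_P] by blast
    then show ?thesis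
      using that by simp
  qed
  have "\<forall>\<^sub>F \<epsilon> in at_right 0. d = (1 / \<epsilon>) *\<^sub>R (closest_point P (x - \<epsilon> *\<^sub>R w) - x)"
    unfolding eventually_at_right_field using quotient \<open>e > 0\<close> by (metis add_0)
  then have "((\<lambda>\<epsilon>. (1 / \<epsilon>) *\<^sub>R (closest_point P (x - \<epsilon> *\<^sub>R w) - x)) \<longlongrightarrow> d) (at_right 0)"
    by (rule Lim_transform_eventually[OF tendsto_const])
  then have shadow: "shadow P x w = d"
    unfolding shadow_def by (intro tendsto_Lim) auto
  show "- w - shadow P x w \<in> normal_cone P x"
    using N by (simp add: shadow normal_cone_def)
  show "(- w - shadow P x w) \<bullet> shadow P x w = 0"
    using d(2) by (simp add: shadow)
  show "\<exists>e>0. \<forall>\<delta>\<in>{0..e}. x + \<delta> *\<^sub>R shadow P x w \<in> P"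
    using e by (auto simp: shadow)
qed

lemma shadow_eq_0_iff:
  fixes a :: "nat \<Rightarrow> real^'n"
  assumes P: "P = {z. \<forall>j\<in>{1..m}. a j \<bullet> z \<le> b j}" and x: "x \<in> P"
    and cl: "closed P" and cv: "convex P"
  shows "shadow P x w = 0 \<longleftrightarrow> - w \<in> normal_cone P x"
proof
  assume "shadow P x w = 0"
  then show "- w \<in> normal_cone P x"
    using shadow_decomposition(1)[OF assms, of w] by simp
next
  define d where "d = shadow P x w"
  assume w: "- w \<in> normal_cone P x"
  obtain e where e: "e > 0" "\<forall>\<delta>\<in>{0..e}. x + \<delta> *\<^sub>R d \<in> P"
    using shadow_decomposition(3)[OF assms, of w] unfolding d_def by blast
  then have "x + e *\<^sub>R d \<in> P" by auto
  then have "- w \<bullet> (x + e *\<^sub>R d - x) \<le> 0"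
    using w unfolding normal_cone_def by blast
  then have "- w \<bullet> d \<le> 0"
    using \<open>e > 0\<close> by (simp add: mult_le_0_iff zero_le_mult_iff)
  moreover have "(- w - d) \<bullet> d = 0"
    using shadow_decomposition(2)[OF assms, of w] by (simp add: d_def)
  ultimately have "d \<bullet> d \<le> 0"
    by (simp add: inner_diff_left)
  then have "d = 0"
    by (metis inner_ge_zero inner_eq_zero_iff order_antisym)
  then show "shadow P x w = 0"
    by (simp add: d_def)
qed

section \<open>Affine pieces and the succession of breakpoints\<close>

lemma affine_piece_iff:
  "affine_piece g s t \<longleftrightarrow>
     0 \<le> s \<and> s < t \<and> (\<exists>c v. v \<noteq> 0 \<and> (\<forall>l\<in>{s..t}. g l = c + l *\<^sub>R v))"
proof
  assume "affine_piece g s t"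
  then obtain v where v: "0 \<le> s" "s < t" "v \<noteq> 0" "\<forall>l\<in>{s..t}. g l = g s + (l - s) *\<^sub>R v"
    unfolding affine_piece_def by blast
  then have "\<forall>l\<in>{s..t}. g l = (g s - s *\<^sub>R v) + l *\<^sub>R v"
    by (metis (no_types, lifting) add.commute add_diff_eq diff_add_eq scaleR_left_diff_distrib)
  then show "0 \<le> s \<and> s < t \<and> (\<exists>c v. v \<noteq> 0 \<and> (\<forall>l\<in>{s..t}. g l = c + l *\<^sub>R v))"
    using v by blast
next
  assume "0 \<le> s \<and> s < t \<and> (\<exists>c v. v \<noteq> 0 \<and> (\<forall>l\<in>{s..t}. g l = c + l *\<^sub>R v))"
  then obtain c v where v: "0 \<le> s" "s < t" "v \<noteq> 0" and g: "\<forall>l\<in>{s..t}. g l = c + l *\<^sub>R v"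
    by blast
  have "g l = g s + (l - s) *\<^sub>R v" if "l \<in> {s..t}" for l
    using g that \<open>s < t\<close> by (simp add: algebra_simps)
  then show "affine_piece g s t"
    unfolding affine_piece_def using v by blast
qed

lemma affine_piece_subinterval:
  "affine_piece g s t \<Longrightarrow> s \<le> s' \<Longrightarrow> s' < t' \<Longrightarrow> t' \<le> t \<Longrightarrow> affine_piece g s' t'"
  unfolding affine_piece_iff by fastforce

lemma affine_piece_inj:
  assumes "affine_piece g s t" "p \<in> {s..t}" "q \<in> {s..t}" "g p = g q"
  shows "p = q"
  using assms unfolding affine_piece_iff by (auto dest: scaleR_right_imp_eq)

lemma affine_map_unique:
  fixes c v :: "real^'n"
  assumes "p < q" "c + p *\<^sub>R v = c' + p *\<^sub>R v'" "c + q *\<^sub>R v = c' + q *\<^sub>R v'"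
  shows "c = c' \<and> v = v'"
proof -
  have "(q - p) *\<^sub>R v = (c + q *\<^sub>R v) - (c + p *\<^sub>R v)"
    by (simp add: algebra_simps)
  also have "\<dots> = (q - p) *\<^sub>R v'"
    unfolding assms(2,3) by (simp add: algebra_simps)
  finally have "v = v'"
    using \<open>p < q\<close> by simp
  then show ?thesis
    using assms(2) by simp
qed

lemma affine_pieces_overlap:
  assumes A: "affine_piece g s t" and B: "affine_piece g s' t'" and "s < t'" "s' < t"
  shows "affine_piece g (min s s') (max t t')"
proof -
  obtain c v where v: "0 \<le> s" "s < t" "v \<noteq> 0" "\<forall>l\<in>{s..t}. g l = c + l *\<^sub>R v"
    using A unfolding affine_piece_iff by blast
  obtain c' v' where v': "0 \<le> s'" "s' < t'" "v' \<noteq> 0" "\<forall>l\<in>{s'..t'}. g l = c' + l *\<^sub>R v'"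
    using B unfolding affine_piece_iff by blast
  define p q where "p = max s s'" and "q = min t t'"
  have pq: "p < q" "p \<in> {s..t}" "p \<in> {s'..t'}" "q \<in> {s..t}" "q \<in> {s'..t'}"
    using assms(3,4) v(2) v'(2) by (auto simp: p_def q_def)
  then have "c + p *\<^sub>R v = c' + p *\<^sub>R v'" "c + q *\<^sub>R v = c' + q *\<^sub>R v'"
    using v(4) v'(4) by metis+
  then have "c = c' \<and> v = v'"
    using affine_map_unique \<open>p < q\<close> by blast
  then have "g l = c + l *\<^sub>R v" if "l \<in> {min s s'..max t t'}" for l
  proof (cases "l \<in> {s..t}")
    case False
    then have "l \<in> {s'..t'}"
      using that assms(3,4) by auto
    then show ?thesis
      using v'(4) \<open>c = c' \<and> v = v'\<close> by simp
  qed (use v(4) in simp)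
  then show ?thesis
    unfolding affine_piece_iff using v(1-3) v'(1) by (intro conjI exI[of _ c] exI[of _ v]) auto
qed

lemma affine_piece_within_maximal:
  assumes M: "maximal_affine_piece g s t" and B: "affine_piece g s' t'" and "s < t'" "s' < t"
  shows "s \<le> s' \<and> t' \<le> t"
proof -
  have "affine_piece g (min s s') (max t t')"
    using affine_pieces_overlap[OF _ B assms(3,4)] M by (simp add: maximal_affine_piece_def)
  moreover have "{s..t} \<subseteq> {min s s'..max t t'}"
    by auto
  ultimately have "min s s' = s \<and> max t t' = t"
    using M unfolding maximal_affine_piece_def by blast
  then show ?thesis by auto
qed

text \<open>The hypothesis \<open>fibre\<close>, that the parameters of a point form an interval, excludes a return of
  the curve to an earlier point. So between the parameter \<open>t1\<close> at which a maximal piece reaches the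
  \<open>i\<close>-th breakpoint (\<open>0\<close> if \<open>i = 1\<close>) and \<open>l\<close> the curve rests. Just before \<open>l\<close> it is therefore at
  rest, or ending its previous maximal piece, or not yet started; in each case a piece that starts at
  \<open>l\<close> cannot be prolonged to the left. It only remains to exclude prolongations to the right.
  No piece ends in \<open>{t1<..<t}\<close>, whence the new number is \<open>Suc i\<close>.\<close>

lemma next_breakpoint:
  fixes g :: "real \<Rightarrow> real^'n"
  assumes fibre: "\<And>p q r. 0 \<le> p \<Longrightarrow> p \<le> q \<Longrightarrow> q \<le> r \<Longrightarrow> g p = g r \<Longrightarrow> g q = g p"
    and bp: "nth_breakpoint g i (g l)"
    and piece: "affine_piece g l t"
    and right: "\<And>t'. t < t' \<Longrightarrow> \<not> affine_piece g l t'"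
  shows "nth_breakpoint g (Suc i) (g t)"
proof -
  have l: "0 \<le> l" "l < t"
    using piece by (auto simp: affine_piece_def)
  \<comment> \<open>A piece cannot run while the curve rests.\<close>
  have avoid: "q \<le> s' \<or> t' \<le> p"
    if A: "affine_piece g s' t'" and pq: "0 \<le> p" "p < q" "g p = g q" for s' t' p q
  proof (rule ccontr)
    assume contra: "\<not> (q \<le> s' \<or> t' \<le> p)"
    define p' q' where "p' = max p s'" and "q' = min q t'"
    have "s' < t'"
      using A by (simp add: affine_piece_def)
    then have "p' < q'" "p \<le> p'" "q' \<le> q" "p' \<in> {s'..t'}" "q' \<in> {s'..t'}"
      using contra pq by (auto simp: p'_def q'_def)
    moreover from this have "g p' = g q'"
      using fibre[of p p' q] fibre[of p q' q] pq by simp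
    ultimately show False
      using affine_piece_inj[OF A] by fastforce
  qed
  have t_end: "maximal_affine_piece g l t"
    if left: "\<And>s' t'. affine_piece g s' t' \<Longrightarrow> t \<le> t' \<Longrightarrow> \<not> s' < l"
    unfolding maximal_affine_piece_def
  proof (intro conjI allI impI)
    show "affine_piece g l t" by (rule piece)
    fix s' t' assume A: "affine_piece g s' t' \<and> {l..t} \<subseteq> {s'..t'}"
    then have st: "s' \<le> l" "t \<le> t'"
      using l by auto
    then show "s' = l"
      using left[of s' t'] A by auto
    have "affine_piece g l t'"
      using affine_piece_subinterval[of g s' t' l t'] A st l by auto
    then show "t' = t"
      using right[of t'] st by force
  qed
  have earlier_ends: "{t'\<in>piece_ends g. t' < t} = {t'\<in>piece_ends g. t' \<le> l}"
    if M: "maximal_affine_piece g l t"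
  proof -
    have "t' \<le> l" if t': "maximal_affine_piece g s' t'" "t' < t" for s' t'
    proof (rule ccontr)
      assume "\<not> t' \<le> l"
      moreover have "s' < t'"
        using t'(1) by (simp add: maximal_affine_piece_def affine_piece_def)
      ultimately show False
        using affine_piece_within_maximal[OF t'(1) piece] t'(2) by auto
    qed
    then show ?thesis
      using l by (auto simp: piece_ends_def)
  qed
  have pos: "affine_piece g s' t' \<Longrightarrow> 0 \<le> s' \<and> s' < t'" for s' t'
    by (simp add: affine_piece_def)
  from bp consider (start) "i = 1" "g l = g 0"
    | (piece_end) t1 where "t1 \<in> piece_ends g" "finite {t'\<in>piece_ends g. t' < t1}"
        "i = card {t'\<in>piece_ends g. t' < t1} + 2" "g l = g t1"
    unfolding nth_breakpoint_def by blast
  then show ?thesis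
  proof cases
    case start
    have before: "\<not> s' < l" if "affine_piece g s' t'" for s' t'
      using avoid[OF that, of 0 l] pos[OF that] start l by auto
    have M: "maximal_affine_piece g l t"
      by (rule t_end) (use before in force)
    have "\<not> t' \<le> l" if "maximal_affine_piece g s' t'" for s' t'
      using before[of s' t'] pos[of s' t'] that by (auto simp: maximal_affine_piece_def)
    then have none: "{t'\<in>piece_ends g. t' < t} = {}"
      unfolding earlier_ends[OF M] by (auto simp: piece_ends_def)
    have "t \<in> piece_ends g"
      using M by (auto simp: piece_ends_def)
    then show ?thesis
      unfolding nth_breakpoint_def by (intro disjI2 bexI[of _ t]) (simp_all add: none start(1))
  next
    case piece_end
    then obtain s1 where s1: "maximal_affine_piece g s1 t1"
      by (auto simp: piece_ends_def)
    then have A1: "affine_piece g s1 t1"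
      by (simp add: maximal_affine_piece_def)
    have t1: "t1 \<le> l"
      using avoid[OF A1, of l t1] pos[OF A1] l piece_end(4) by force
    have rest: "l \<le> s' \<or> t' \<le> t1" if "affine_piece g s' t'" "t1 < l" for s' t'
      using avoid[OF that(1), of t1 l] pos[OF A1] that piece_end(4) by auto
    have M: "maximal_affine_piece g l t"
    proof (rule t_end)
      fix s' t' assume A: "affine_piece g s' t'" "t \<le> t'"
      show "\<not> s' < l"
      proof (cases "t1 = l")
        case True
        then show ?thesis
          using affine_piece_within_maximal[OF s1 A(1)] A(2) pos[OF A1] l by auto
      next
        case False
        then show ?thesis
          using rest[OF A(1)] t1 A(2) l by auto
      qed
    qed
    have "t' \<le> t1" if "maximal_affine_piece g s' t'" "t' \<le> l" for s' t'
      using rest[of s' t'] pos[of s' t'] that t1 by (force simp: maximal_affine_piece_def)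
    then have ends: "{t'\<in>piece_ends g. t' < t} = insert t1 {t'\<in>piece_ends g. t' < t1}"
      unfolding earlier_ends[OF M] using t1 piece_end(1) by (force simp: piece_ends_def)
    have "t \<in> piece_ends g"
      using M by (auto simp: piece_ends_def)
    moreover have "card {t'\<in>piece_ends g. t' < t} + 2 = Suc i"
      unfolding ends using piece_end(2,3) by simp
    moreover have "finite {t'\<in>piece_ends g. t' < t}"
      unfolding ends using piece_end(2) by simp
    ultimately show ?thesis
      unfolding nth_breakpoint_def by (intro disjI2 bexI[of _ t]) auto
  qed
qed

section \<open>The projections curve\<close>

lemma projections_curve_eq_iff:
  fixes P :: "(real^'n) set"
  assumes "closed P" "convex P" "p \<in> P"
  shows "projections_curve P x0 w l = p \<longleftrightarrow> x0 - l *\<^sub>R w - p \<in> normal_cone P p"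
  unfolding projections_curve_def by (rule closest_point_eq_iff_normal_cone[OF assms])

lemma projections_curve_in:
  assumes "closed P" "P \<noteq> {}"
  shows "projections_curve P x0 w l \<in> P"
  unfolding projections_curve_def using assms by (rule closest_point_in_set)

lemma continuous_projections_curve:
  fixes P :: "(real^'n) set"
  assumes "closed P" "convex P" "P \<noteq> {}"
  shows "continuous_on A (projections_curve P x0 w)"
  unfolding projections_curve_def
  by (intro continuous_on_compose2[OF continuous_on_closest_point[OF assms(2,1,3), of UNIV]]
        continuous_intros) auto

lemma projections_curve_fibre_interval:
  fixes P :: "(real^'n) set"
  assumes P: "closed P" "convex P" "P \<noteq> {}"
    and "p \<le> q" "q \<le> r" and eq: "projections_curve P x0 w p = projections_curve P x0 w r"
  shows "projections_curve P x0 w q = projections_curve P x0 w p"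
proof (cases "p = r")
  case False
  define y where "y = projections_curve P x0 w p"
  have y: "y \<in> P"
    unfolding y_def using P by (intro projections_curve_in)
  note N = projections_curve_eq_iff[OF P(1,2) y, of x0 w]
  \<comment> \<open>The residuals at \<open>p\<close> and \<open>r\<close> are normal at the same point, and the one at \<open>q\<close> is a
    convex combination of them.\<close>
  define u where "u = (q - p) / (r - p)"
  have u: "0 \<le> u" "0 \<le> 1 - u"
    using assms(4,5) False by (auto simp: u_def divide_simps)
  have "q = (1 - u) * p + u * r"
  proof -
    have "u * (r - p) = q - p"
      using False by (simp add: u_def)
    then show ?thesis
      by (simp add: algebra_simps)
  qed
  then have "x0 - q *\<^sub>R w - y = x0 - ((1 - u) * p + u * r) *\<^sub>R w - y"
    by simp
  then have "(1 - u) *\<^sub>R (x0 - p *\<^sub>R w - y) + u *\<^sub>R (x0 - r *\<^sub>R w - y) = x0 - q *\<^sub>R w - y"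
    by (simp add: algebra_simps)
  moreover have "(1 - u) *\<^sub>R (x0 - p *\<^sub>R w - y) + u *\<^sub>R (x0 - r *\<^sub>R w - y) \<in> normal_cone P y"
  proof (rule convexD[OF convex_normal_cone])
    show "x0 - p *\<^sub>R w - y \<in> normal_cone P y" "x0 - r *\<^sub>R w - y \<in> normal_cone P y"
      using N[of p] N[of r] eq y_def by metis+
  qed (use u in auto)
  ultimately show ?thesis
    using N[of q] by (simp add: y_def)
qed (use assms in auto)

text \<open>Dividing the normal vector \<open>x0 - l w - g l\<close> by \<open>l\<close> and letting \<open>l\<close> grow leaves \<open>- w\<close>, because
  \<open>g\<close> is bounded. Hence the cone at \<open>x\<close> serves arbitrarily large parameters only at the end point
  of the curve.\<close>

lemma normal_cone_unbounded_parameters: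
  fixes P :: "(real^'n) set"
  assumes bdd: "bounded P" and g: "\<And>l. g l \<in> P"
    and large: "\<And>L. \<exists>l\<ge>L. x0 - l *\<^sub>R w - g l \<in> normal_cone P x"
  shows "- w \<in> normal_cone P x"
  unfolding normal_cone_def
proof (intro CollectI ballI, rule ccontr)
  fix z assume z: "z \<in> P"
  define c where "c = - w \<bullet> (z - x)"
  assume "\<not> - w \<bullet> (z - x) \<le> 0"
  then have "c > 0"
    by (simp add: c_def)
  obtain B where B: "\<And>y. y \<in> P \<Longrightarrow> norm y \<le> B"
    using bdd bounded_iff by blast
  define K where "K = (norm x0 + B) * norm (z - x)"
  obtain l where l: "l \<ge> (K + 1) / c" "x0 - l *\<^sub>R w - g l \<in> normal_cone P x"
    using large by blast
  have "\<bar>(x0 - g l) \<bullet> (z - x)\<bar> \<le> norm (x0 - g l) * norm (z - x)"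
    by (rule Cauchy_Schwarz_ineq2)
  also have "\<dots> \<le> K"
    unfolding K_def using B[OF g[of l]] norm_triangle_ineq4[of x0 "g l"]
    by (intro mult_right_mono) auto
  finally have "- K \<le> (x0 - g l) \<bullet> (z - x)" by simp
  moreover have "(x0 - l *\<^sub>R w - g l) \<bullet> (z - x) \<le> 0"
    using l(2) z by (simp add: normal_cone_def)
  moreover have "(x0 - l *\<^sub>R w - g l) \<bullet> (z - x) = (x0 - g l) \<bullet> (z - x) + l * c"
    by (simp add: c_def algebra_simps)
  moreover have "l * c \<ge> K + 1"
    using l(1) \<open>c > 0\<close> by (simp add: divide_le_eq)
  ultimately show False by linarith
qed

text \<open>Adding a nonnegative multiple of \<open>- w - d\<close> to a normal vector at \<open>x\<close> that is orthogonal to \<open>d\<close> keeps both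
  properties, and a normal vector at \<open>x\<close> orthogonal to \<open>d\<close> is normal at every point of \<open>P\<close> on the ray.\<close>

lemma projections_curve_shadow_step:
  fixes P :: "(real^'n) set"
  assumes P: "closed P" "convex P" "x \<in> P"
    and gl: "projections_curve P x0 w l0 = x"
    and N: "- w - d \<in> normal_cone P x" and orth: "(- w - d) \<bullet> d = 0"
    and orth0: "(x0 - l0 *\<^sub>R w - x) \<bullet> d = 0"
    and \<delta>: "0 \<le> \<delta>" "x + \<delta> *\<^sub>R d \<in> P"
  shows "projections_curve P x0 w (l0 + \<delta>) = x + \<delta> *\<^sub>R d"
proof -
  have "(x0 - (l0 + \<delta>) *\<^sub>R w - (x + \<delta> *\<^sub>R d)) \<bullet> (z - (x + \<delta> *\<^sub>R d)) \<le> 0" if z: "z \<in> P" for z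
  proof -
    have "x0 - l0 *\<^sub>R w - x \<in> normal_cone P x"
      using gl projections_curve_eq_iff[OF P] by blast
    then have "(x0 - l0 *\<^sub>R w - x) \<bullet> (z - x) \<le> 0"
      using z by (simp add: normal_cone_def)
    moreover have "\<delta> * ((- w - d) \<bullet> (z - x)) \<le> 0"
      using N z \<delta>(1) by (simp add: normal_cone_def mult_nonneg_nonpos)
    moreover have "(x0 - (l0 + \<delta>) *\<^sub>R w - (x + \<delta> *\<^sub>R d)) \<bullet> (z - (x + \<delta> *\<^sub>R d))
        = (x0 - l0 *\<^sub>R w - x) \<bullet> (z - x) + \<delta> * ((- w - d) \<bullet> (z - x))
          - \<delta> * ((x0 - l0 *\<^sub>R w - x) \<bullet> d) - \<delta> * \<delta> * ((- w - d) \<bullet> d)"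
      by (simp add: algebra_simps)
    ultimately show ?thesis
      unfolding orth orth0 by simp
  qed
  then have "x0 - (l0 + \<delta>) *\<^sub>R w - (x + \<delta> *\<^sub>R d) \<in> normal_cone P (x + \<delta> *\<^sub>R d)"
    by (simp add: normal_cone_def)
  then show ?thesis
    using projections_curve_eq_iff[OF P(1,2) \<delta>(2)] by blast
qed

text \<open>Equal normal cones mean equal tight constraints, so the displacement \<open>g l - x\<close> lies in the
  subspace \<open>L\<close> of in-face directions, while both residuals are normal at \<open>x\<close> and hence orthogonal
  to \<open>L\<close>. Thus \<open>g l - x\<close> is the orthogonal projection of \<open>- (l - l0) w\<close> onto \<open>L\<close>.\<close>

lemma projections_curve_in_face_step:
  fixes a :: "nat \<Rightarrow> real^'n"
  assumes P: "P = {z. \<forall>j\<in>{1..m}. a j \<bullet> z \<le> b j}" and x: "x \<in> P"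
    and cl: "closed P" and cv: "convex P"
    and gl0: "projections_curve P x0 w l0 = x"
    and same: "normal_cone P (projections_curve P x0 w l) = normal_cone P x"
  shows "projections_curve P x0 w l = x + (l - l0) *\<^sub>R in_face_shadow a b m x w"
proof -
  define I where "I = tight_constraints a b m x"
  define L where "L = {v. \<forall>j\<in>I. a j \<bullet> v = 0}"
  define d where "d = closest_point L (- w)"
  have d_eq: "in_face_shadow a b m x w = d"
    by (simp add: in_face_shadow_def d_def L_def I_def)
  define y where "y = projections_curve P x0 w l"
  have y: "y \<in> P"
    unfolding y_def using cl x by (intro projections_curve_in) auto
  have I_y: "tight_constraints a b m y = I"
    unfolding I_def using normal_cone_eq_imp_tight_eq[OF P x y] same by (simp add: y_def)
  have "y - x \<in> L"
    using I_y by (auto simp: L_def I_def tight_constraints_def inner_diff_right)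
  have L_eq: "L = (\<Inter>j\<in>I. {v. a j \<bullet> v = 0})"
    by (auto simp: L_def)
  have L: "closed L" "convex L" "cone L" "0 \<in> L"
    unfolding L_eq by (auto simp: closed_hyperplane cone_def intro: convex_INT convex_hyperplane)
  then have d: "d \<in> L" "\<And>v. v \<in> L \<Longrightarrow> (- w - d) \<bullet> v \<le> 0"
    unfolding d_def by (auto intro: closest_point_cone)
  have d_orth: "(- w - d) \<bullet> v = 0" if "v \<in> L" for v
  proof -
    have "- v \<in> L"
      using that by (simp add: L_def)
    then show ?thesis
      using d(2)[OF that] d(2)[of "- v"] by (simp del: minus_diff_eq)
  qed
  have res: "x0 - l0 *\<^sub>R w - x \<in> normal_cone P x" "x0 - l *\<^sub>R w - y \<in> normal_cone P x"
    using projections_curve_eq_iff[OF cl cv x, of x0 w l0] gl0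
      projections_curve_eq_iff[OF cl cv y, of x0 w l] same
    by (auto simp: y_def)
  \<comment> \<open>The error \<open>u\<close> lies in \<open>L\<close> and is a linear combination of vectors orthogonal to \<open>L\<close>.\<close>
  define u where "u = y - x - (l - l0) *\<^sub>R d"
  have "u \<in> L"
    using \<open>y - x \<in> L\<close> d(1) by (simp add: u_def L_def inner_diff_right)
  then have u0: "\<And>j. j \<in> tight_constraints a b m x \<Longrightarrow> a j \<bullet> u = 0"
    by (simp add: L_def I_def)
  have "(x0 - l0 *\<^sub>R w - x) \<bullet> u = 0" "(x0 - l *\<^sub>R w - y) \<bullet> u = 0"
    using normal_cone_orthogonal_in_face[OF P x _ u0] res by auto
  moreover have "(- w - d) \<bullet> u = 0"
    using d_orth[OF \<open>u \<in> L\<close>] .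
  moreover have "u = (x0 - l0 *\<^sub>R w - x) - (x0 - l *\<^sub>R w - y) + (l - l0) *\<^sub>R (- w - d)"
    by (simp add: u_def algebra_simps)
  then have "u \<bullet> u = (x0 - l0 *\<^sub>R w - x) \<bullet> u - (x0 - l *\<^sub>R w - y) \<bullet> u + (l - l0) * ((- w - d) \<bullet> u)"
    by (metis inner_add_left inner_diff_left inner_scaleR_left)
  ultimately have "u = 0" by simp
  then have "y = x + (l - l0) *\<^sub>R d"
    by (simp add: u_def algebra_simps)
  then show ?thesis
    by (simp add: y_def d_eq)
qed

text \<open>This is why an in-face step cannot be prolonged beyond the change of the normal cone: all
  interior points of an affine piece share one normal cone.\<close>

lemma affine_piece_within_constant_normal_cone:
  fixes P :: "(real^'n) set"
  assumes g: "\<And>l. g l \<in> P" and piece: "affine_piece g l0 t"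
    and q: "l0 < q" "q < t" and same: "\<And>l. l \<in> {l0..<q} \<Longrightarrow> normal_cone P (g l) = normal_cone P x"
  shows "\<forall>l\<in>{l0..<t}. normal_cone P (g l) = normal_cone P x"
proof
  fix l assume l: "l \<in> {l0..<t}"
  obtain c v where v: "\<forall>l\<in>{l0..t}. g l = c + l *\<^sub>R v"
    using piece unfolding affine_piece_iff by blast
  show "normal_cone P (g l) = normal_cone P x"
  proof (cases "l = l0")
    case False
    define p where "p = (l0 + q) / 2"
    have p: "p \<in> {l0<..<t}" "p \<in> {l0..<q}"
      using q by (auto simp: p_def)
    have "normal_cone P (c + l *\<^sub>R v) = normal_cone P (c + p *\<^sub>R v)"
      by (rule normal_cone_constant_along_open_segment[of l0 t])
        (use False l p v g in \<open>auto simp flip: v[rule_format]\<close>)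
    then have "normal_cone P (g l) = normal_cone P (g p)"
      using v l p by simp
    then show ?thesis
      using same[OF p(2)] by simp
  qed (use same q in simp)
qed

lemma max_step_greatest:
  fixes P :: "(real^'n) set"
  assumes "compact P" "x \<in> P" "d \<noteq> 0"
  shows "x + max_step P x d *\<^sub>R d \<in> P" "\<And>\<delta>. x + \<delta> *\<^sub>R d \<in> P \<Longrightarrow> \<delta> \<le> max_step P x d"
proof -
  define S where "S = (\<lambda>\<delta>. x + \<delta> *\<^sub>R d) -` P"
  have "closed S"
    unfolding S_def
    by (intro closed_vimage compact_imp_closed assms) (intro continuous_intros)
  moreover have "bounded S"
  proof -
    obtain B where B: "\<And>y. y \<in> P \<Longrightarrow> norm y \<le> B"
      using compact_imp_bounded[OF assms(1)] bounded_iff by blast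
    have "norm \<delta> \<le> (B + norm x) / norm d" if "\<delta> \<in> S" for \<delta>
    proof -
      have "norm (\<delta> *\<^sub>R d) \<le> norm (x + \<delta> *\<^sub>R d) + norm x"
        by (metis add_diff_cancel_left' norm_triangle_ineq4)
      also have "\<dots> \<le> B + norm x"
        using B that by (simp add: S_def)
      finally show ?thesis
        using assms(3) by (simp add: le_divide_eq)
    qed
    then show ?thesis
      unfolding bounded_iff by blast
  qed
  moreover have "0 \<in> S"
    using assms(2) by (simp add: S_def)
  ultimately obtain M where M: "M \<in> S" "\<And>\<delta>. \<delta> \<in> S \<Longrightarrow> \<delta> \<le> M"
    using compact_attains_sup[of S] by (auto simp: compact_eq_bounded_closed)
  have "max_step P x d = M"
    unfolding max_step_def by (rule Greatest_equality) (use M in \<open>auto simp: S_def\<close>)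
  then show "x + max_step P x d *\<^sub>R d \<in> P" "\<And>\<delta>. x + \<delta> *\<^sub>R d \<in> P \<Longrightarrow> \<delta> \<le> max_step P x d"
    using M by (auto simp: S_def)
qed

section \<open>The end of the curve, shadow steps and in-face steps\<close>

theorem theorem3:
  fixes a :: "nat \<Rightarrow> real^'n" and b :: "nat \<Rightarrow> real" and m i :: nat
    and P :: "(real^'n) set"
    and h :: "real^'n \<Rightarrow> real" and grad_h :: "real^'n \<Rightarrow> real^'n"
    and x0 x :: "real^'n" and l0 :: real
  assumes P_eq: "P = {z. \<forall>j\<in>{1..m}. a j \<bullet> z \<le> b j}"
    and P_polytope: "polytope P"
    and h_diff: "\<forall>z\<in>P. (h has_derivative (\<lambda>v. grad_h z \<bullet> v)) (at z within P)"
    and x0_in: "x0 \<in> P"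
    and x_break: "nth_breakpoint (projections_curve P x0 (grad_h x0)) i x"
    and l0_nonneg: "0 \<le> l0"
    and g_l0: "projections_curve P x0 (grad_h x0) l0 = x"
  shows "let w = grad_h x0;
             g = projections_curve P x0 w;
             d = shadow P x w;
             d_hat = in_face_shadow a b m x w;
             l_plus = last_parameter g x;
             l_minus_next = l0 + max_step P x d;
             l_hat = normal_cone_change P g x l0;
             x_shadow = x + (l_minus_next - l0) *\<^sub>R d;
             x_in_face = x + (l_hat - l0) *\<^sub>R d_hat
         in
           (d = 0 \<longrightarrow> (g \<longlongrightarrow> x) at_top \<and> (\<forall>l\<ge>l0. g l = x)) \<and>
           (d \<noteq> 0 \<and> (x0 - l0 *\<^sub>R w - x) \<bullet> d = 0 \<longrightarrow>
              (\<forall>l\<in>{l0..l_minus_next}. g l = x + (l - l0) *\<^sub>R d) \<and>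
              nth_breakpoint g (Suc i) x_shadow) \<and>
           (d \<noteq> 0 \<and> (x0 - l0 *\<^sub>R w - x) \<bullet> d \<noteq> 0 \<longrightarrow>
              l0 \<le> l_hat \<and>
              (\<forall>l\<in>{l0..l_hat}. g l = x + (l - l0) *\<^sub>R d_hat) \<and>
              (if l0 < l_plus
               then d_hat = 0 \<and> l_hat = l_plus \<and> x_in_face = x
               else l0 < l_hat \<longrightarrow> d_hat \<noteq> 0 \<and> nth_breakpoint g (Suc i) x_in_face))"
proof -
  define w where "w = grad_h x0"
  define g where "g = projections_curve P x0 w"
  define d where "d = shadow P x w"
  define d_hat where "d_hat = in_face_shadow a b m x w"
  define l_plus where "l_plus = last_parameter g x"
  define M where "M = max_step P x d"
  define l_hat where "l_hat = normal_cone_change P g x l0"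
  have comp: "compact P" and cv: "convex P"
    using P_polytope by (auto simp: polytope_imp_compact polytope_imp_convex)
  have cl: "closed P" and bdd: "bounded P" and ne: "P \<noteq> {}"
    using comp x0_in by (auto simp: compact_imp_closed compact_imp_bounded)
  have g_in: "g l \<in> P" for l
    unfolding g_def using projections_curve_in[OF cl ne] .
  have gl0: "g l0 = x"
    using g_l0 by (simp add: g_def w_def)
  then have x: "x \<in> P"
    using g_in by metis
  have bp: "nth_breakpoint g i (g l0)"
    using x_break gl0 by (simp add: g_def w_def)
  note g_iff = projections_curve_eq_iff[OF cl cv, where ?x0.0 = x0 and w = w, folded g_def]
  have fibre: "g q = g p" if "p \<le> q" "q \<le> r" "g p = g r" for p q r
    using projections_curve_fibre_interval[OF cl cv ne that(1,2)] that(3) by (simp add: g_def)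
  note d_props = shadow_decomposition[OF P_eq x cl cv, of w, folded d_def]
  have N0: "x0 - l0 *\<^sub>R w - x \<in> normal_cone P x"
    using g_iff[OF x] gl0 by blast
  have step: "nth_breakpoint g (Suc i) (g t)"
    if "affine_piece g l0 t" "\<And>t'. t < t' \<Longrightarrow> \<not> affine_piece g l0 t'" for t
    by (rule next_breakpoint[OF fibre bp]) (use that in auto)

  have end_point: "(g \<longlongrightarrow> x) at_top \<and> (\<forall>l\<ge>l0. g l = x)" if "d = 0"
  proof -
    have "- w \<in> normal_cone P x"
      using d_props(1) that by simp
    have const: "g l = x" if "l \<ge> l0" for l
    proof -
      have "(x0 - l *\<^sub>R w - x) \<bullet> (z - x) \<le> 0" if "z \<in> P" for z
      proof -
        have "(x0 - l0 *\<^sub>R w - x) \<bullet> (z - x) \<le> 0" "(l - l0) * (- w \<bullet> (z - x)) \<le> 0"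
          using N0 \<open>- w \<in> normal_cone P x\<close> \<open>z \<in> P\<close> \<open>l \<ge> l0\<close>
          by (auto simp: normal_cone_def intro!: mult_nonneg_nonpos)
        moreover have "(x0 - l *\<^sub>R w - x) \<bullet> (z - x)
            = (x0 - l0 *\<^sub>R w - x) \<bullet> (z - x) + (l - l0) * (- w \<bullet> (z - x))"
          by (simp add: algebra_simps)
        ultimately show ?thesis by linarith
      qed
      then show ?thesis
        using g_iff[OF x] by (simp add: normal_cone_def)
    qed
    then have "\<forall>\<^sub>F l in at_top. x = g l"
      by (intro eventually_mono[OF eventually_ge_at_top[of l0]]) simp
    then show ?thesis
      using const Lim_transform_eventually[OF tendsto_const] by blast
  qed

  have shadow_step: "(\<forall>l\<in>{l0..l0 + M}. g l = x + (l - l0) *\<^sub>R d)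
      \<and> nth_breakpoint g (Suc i) (x + M *\<^sub>R d)"
    if dn: "d \<noteq> 0" and orth: "(x0 - l0 *\<^sub>R w - x) \<bullet> d = 0"
  proof -
    note M = max_step_greatest[OF comp x dn, folded M_def]
    obtain e where "e > 0" "\<forall>\<delta>\<in>{0..e}. x + \<delta> *\<^sub>R d \<in> P"
      using d_props(3) by blast
    then have "x + e *\<^sub>R d \<in> P" by auto
    then have "0 < M"
      using M(2) \<open>e > 0\<close> by force
    have aff: "g l = x + (l - l0) *\<^sub>R d" if l: "l \<in> {l0..l0 + M}" for l
    proof -
      have "closed_segment x (x + M *\<^sub>R d) \<subseteq> P"
        using cv x M(1) by (simp add: convex_contains_segment)
      moreover have "x + (l - l0) *\<^sub>R d \<in> closed_segment x (x + M *\<^sub>R d)"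
      proof -
        define u where "u = (l - l0) / M"
        have u: "0 \<le> u" "u \<le> 1" "l - l0 = u * M"
          using l \<open>0 < M\<close> by (auto simp: u_def divide_simps)
        have "x + (l - l0) *\<^sub>R d = (1 - u) *\<^sub>R x + u *\<^sub>R (x + M *\<^sub>R d)"
          unfolding u(3) by (simp add: algebra_simps)
        then show ?thesis
          unfolding in_segment using u by blast
      qed
      ultimately have "x + (l - l0) *\<^sub>R d \<in> P" by blast
      then show ?thesis
        using projections_curve_shadow_step[OF cl cv x gl0[unfolded g_def] d_props(1,2) orth, of "l - l0"] l
        by (simp add: g_def)
    qed
    have "affine_piece g l0 (l0 + M)"
      unfolding affine_piece_def using l0_nonneg \<open>0 < M\<close> dn aff gl0 by auto
    moreover have "\<not> affine_piece g l0 t'" if t': "l0 + M < t'" for t'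
    proof
      assume "affine_piece g l0 t'"
      then obtain v where v: "\<forall>l\<in>{l0..t'}. g l = x + (l - l0) *\<^sub>R v"
        unfolding affine_piece_def gl0 by blast
      then have "x + M *\<^sub>R v = x + M *\<^sub>R d"
        using aff[of "l0 + M"] v[rule_format, of "l0 + M"] t' \<open>0 < M\<close> by simp
      then have "v = d"
        using \<open>0 < M\<close> by simp
      then have "x + (t' - l0) *\<^sub>R d \<in> P"
        using v[rule_format, of t'] g_in[of t'] t' \<open>0 < M\<close> by simp
      then show False
        using M(2) t' by force
    qed
    ultimately have "nth_breakpoint g (Suc i) (g (l0 + M))"
      by (rule step)
    then show ?thesis
      using aff \<open>0 < M\<close> by auto
  qed

  have in_face_step: "l0 \<le> l_hat \<and> (\<forall>l\<in>{l0..l_hat}. g l = x + (l - l0) *\<^sub>R d_hat) \<and>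
      (if l0 < l_plus then d_hat = 0 \<and> l_hat = l_plus \<and> x + (l_hat - l0) *\<^sub>R d_hat = x
       else l0 < l_hat \<longrightarrow> d_hat \<noteq> 0 \<and> nth_breakpoint g (Suc i) (x + (l_hat - l0) *\<^sub>R d_hat))"
    if dn: "d \<noteq> 0"
  proof -
    have w: "- w \<notin> normal_cone P x"
      using dn shadow_eq_0_iff[OF P_eq x cl cv, of w] by (simp add: d_def)
    then obtain L where L: "\<And>l. l \<ge> L \<Longrightarrow> x0 - l *\<^sub>R w - g l \<notin> normal_cone P x"
      using normal_cone_unbounded_parameters[OF bdd, of g x0 w x] g_in by blast
    have res: "x0 - l *\<^sub>R w - g l \<in> normal_cone P (g l)" for l
      using g_iff[OF g_in[of l]] by blast
    define S where "S = {l. \<forall>l'\<in>{l0..<l}. normal_cone P (g l') = normal_cone P x}"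
    have "l0 \<in> S"
      by (simp add: S_def)
    \<comment> \<open>Without this bound, \<open>Sup S\<close> would be an unspecified real.\<close>
    have "l \<le> max l0 L" if "l \<in> S" for l
    proof (rule ccontr)
      assume "\<not> l \<le> max l0 L"
      then have "max l0 L \<in> {l0..<l}"
        by auto
      then have "normal_cone P (g (max l0 L)) = normal_cone P x"
        using that unfolding S_def by blast
      then show False
        using res[of "max l0 L"] L[of "max l0 L"] by simp
    qed
    then have bS: "bdd_above S"
      by (intro bdd_aboveI)
    have l_hat: "l_hat = Sup S"
      by (simp add: l_hat_def normal_cone_change_def S_def)
    have up: "l \<le> l_hat" if "l \<in> S" for l
      unfolding l_hat using bS that by (rule cSup_upper[rotated])
    have le: "l0 \<le> l_hat"
      using up[OF \<open>l0 \<in> S\<close>] .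
    have same: "normal_cone P (g l) = normal_cone P x" if "l \<in> {l0..<l_hat}" for l
    proof -
      have "l < Sup S" "S \<noteq> {}"
        using that \<open>l0 \<in> S\<close> by (auto simp: l_hat)
      then obtain l' where "l' \<in> S" "l < l'"
        using less_cSup_iff[OF _ bS] by blast
      then show ?thesis
        using that by (auto simp: S_def)
    qed
    have open_aff: "g l = x + (l - l0) *\<^sub>R d_hat" if "l \<in> {l0..<l_hat}" for l
      unfolding g_def d_hat_def
      by (rule projections_curve_in_face_step[OF P_eq x cl cv gl0[unfolded g_def]])
        (use same[OF that] that in \<open>auto simp: g_def\<close>)
    have aff: "g l = x + (l - l0) *\<^sub>R d_hat" if l: "l \<in> {l0..l_hat}" for l
    proof (cases "l = l0")
      case False
      then have "l0 < l_hat" using l by auto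
      \<comment> \<open>At \<open>l_hat\<close> itself the normal cone may already differ; continuity carries the formula over.\<close>
      have cont: "continuous_on {l0..l_hat} (\<lambda>l. g l - (x + (l - l0) *\<^sub>R d_hat))"
        unfolding g_def by (intro continuous_intros continuous_projections_curve cl cv ne)
      have "closed {l \<in> {l0..l_hat}. g l - (x + (l - l0) *\<^sub>R d_hat) = 0}"
        by (rule continuous_closed_preimage_constant[OF cont]) simp
      moreover have "{l0..<l_hat} \<subseteq> {l \<in> {l0..l_hat}. g l - (x + (l - l0) *\<^sub>R d_hat) = 0}"
        using open_aff by auto
      ultimately have "closure {l0..<l_hat} \<subseteq> {l \<in> {l0..l_hat}. g l - (x + (l - l0) *\<^sub>R d_hat) = 0}"
        by (rule closure_minimal[rotated])
      then have "{l0..l_hat} \<subseteq> {l. g l - (x + (l - l0) *\<^sub>R d_hat) = 0}"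
        using \<open>l0 < l_hat\<close> by auto
      then show ?thesis using l by auto
    qed (simp add: gl0)
    define F where "F = {l. 0 \<le> l \<and> g l = x}"
    have "l \<le> L" if "l \<in> F" for l
      using that L[of l] res[of l] by (force simp: F_def)
    then have bF: "bdd_above F"
      by (intro bdd_aboveI)
    have "closed F"
    proof -
      have "F = {0..} \<inter> g -` {x}"
        by (auto simp: F_def)
      moreover have "continuous_on {0..} g"
        unfolding g_def by (rule continuous_projections_curve[OF cl cv ne])
      ultimately show ?thesis
        using continuous_closed_preimage[of "{0..}" g "{x}"] by auto
    qed
    have "l0 \<in> F"
      using gl0 l0_nonneg by (simp add: F_def)
    have "Sup F \<in> F"
      using closed_contains_Sup[OF _ bF \<open>closed F\<close>] \<open>l0 \<in> F\<close> by blast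
    moreover have "l \<le> Sup F" if "l \<in> F" for l
      using that bF by (rule cSup_upper)
    ultimately have "l_plus = Sup F"
      unfolding l_plus_def last_parameter_def by (intro Greatest_equality) (auto simp: F_def)
    then have plus: "g l_plus = x" "\<And>l. 0 \<le> l \<Longrightarrow> g l = x \<Longrightarrow> l \<le> l_plus"
      using \<open>Sup F \<in> F\<close> cSup_upper[OF _ bF] by (auto simp: F_def)
    have rest: "d_hat = 0 \<and> l_hat = l_plus \<and> x + (l_hat - l0) *\<^sub>R d_hat = x" if "l0 < l_plus"
    proof -
      have "g l = x" if "l \<in> {l0..<l_plus}" for l
        using fibre[of l0 l l_plus] that plus(1) gl0 by simp
      then have "l_plus \<le> l_hat"
        by (intro up) (simp add: S_def)
      then have "x = x + (l_plus - l0) *\<^sub>R d_hat"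
        using aff[of l_plus] \<open>l0 < l_plus\<close> plus(1) by simp
      then have "d_hat = 0"
        using \<open>l0 < l_plus\<close> by simp
      moreover from this have "l_hat \<le> l_plus"
        using aff[of l_hat] le l0_nonneg by (intro plus(2)) auto
      ultimately show ?thesis
        using \<open>l_plus \<le> l_hat\<close> by simp
    qed
    have move: "d_hat \<noteq> 0 \<and> nth_breakpoint g (Suc i) (x + (l_hat - l0) *\<^sub>R d_hat)"
      if "\<not> l0 < l_plus" "l0 < l_hat"
    proof -
      have "d_hat \<noteq> 0"
      proof
        assume "d_hat = 0"
        then have "l_hat \<le> l_plus"
          using aff[of l_hat] le l0_nonneg by (intro plus(2)) auto
        then show False
          using that by simp
      qed
      then have "affine_piece g l0 l_hat"
        unfolding affine_piece_def using l0_nonneg that(2) aff gl0 by auto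
      moreover have "\<not> affine_piece g l0 t'" if "l_hat < t'" for t'
      proof
        assume "affine_piece g l0 t'"
        then have "\<forall>l\<in>{l0..<t'}. normal_cone P (g l) = normal_cone P x"
          by (rule affine_piece_within_constant_normal_cone[OF g_in _ \<open>l0 < l_hat\<close> that]) (rule same)
        then have "t' \<in> S"
          by (simp add: S_def)
        then show False
          using up that by force
      qed
      ultimately have "nth_breakpoint g (Suc i) (g l_hat)"
        by (rule step)
      then show ?thesis
        using aff[of l_hat] le \<open>d_hat \<noteq> 0\<close> by simp
    qed
    show ?thesis
      using le aff rest move by simp
  qed

  show ?thesis
    unfolding Let_def
    unfolding w_def[symmetric] g_def[symmetric]
    unfolding d_def[symmetric] d_hat_def[symmetric] l_plus_def[symmetric] l_hat_def[symmetric]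
    unfolding M_def[symmetric]
    using end_point shadow_step in_face_step by simp
qed

end
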